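(* Let $A=(a_{ij})\in\mathbb{R}^{m\times n}$ have full column rank, let $b\in\mathbb{R}^m$, and suppose the linear system $Ax=b$ is consistent, with solution $x^*$. Let $\alpha>0$ and let $x^{+}$ be the (random) point obtained from $x\in\mathbb{R}^n$ by one iteration of the doubly stochastic Gauss-Seidel (DSGS) algorithm with stepsize $\alpha$ (described in the context). Write $\Delta=x-x^*$ and $\Delta^{+}=x^{+}-x^*$. Then $$\mathbb{E}\left[\|\Delta^{+}\|^2\mid x\right]\le \Delta^T\left(I+\frac{n\alpha^2-2\alpha}{\sum_{i,j}a_{ij}^2}A^TA\right)\Delta .$$ Consequently, for $0<\alpha<2/n$ the DSGS algorithm converges globally linearly in the mean squared error sense: there is $\rho\in[0,1)$, depending only on $A$ and $\alpha$, such that for every initial point $x^0$ the iterates satisfy $\mathbb{E}\left[\|x^r-x^*\|^2\right]\le\rho^r\|x^0-x^*\|^2$ for all $r\ge 0$. Moreover, if $\alpha=1/n$, then $$\mathbb{E}\left[\|\Delta^{+}\|^2\mid x\right]\le\left(1-\frac{1}{n\,\kappa^2(A)}\right)\|\Delta\|^2\le\left(1-\frac{1}{n^2\,k^2(A)}\right)\|\Delta\|^2 .$$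
   Context: DSGS algorithm for $Ax=b$ with stepsize $\alpha>0$: given the current iterate $x\in\mathbb{R}^n$, select (independently of the past) one index pair $(i,j)\in\{1,\dots,m\}\times\{1,\dots,n\}$ with probability $p_{ij}=a_{ij}^2/\sum_{i',j'}a_{i'j'}^2$ (so pairs with $a_{ij}=0$ are never selected), and set $$x_j^{+}=x_j+\alpha\,\frac{b_i-\sum_{k=1}^n a_{ik}x_k}{a_{ij}},\qquad x_k^{+}=x_k\ \text{ for all } k\ne j .$$ The iterates $x^0,x^1,x^2,\dots$ are obtained by repeating this step. Notation: $\|\cdot\|$ is the Euclidean norm, $\|A\|_2$ the spectral norm, $\|A\|_F$ the Frobenius norm. $\|A^{\dagger}\|_2$ denotes the smallest constant $M$ such that $\|Ax\|_2\ge\frac1M\|x\|_2$ for all $x$. The relative condition number is $k(A)=\|A\|_2\|A^{\dagger}\|_2$ and the scaled condition number is $\kappa(A)=\|A\|_F\|A^{\dagger}\|_2$. *)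

theory Defs
  imports "HOL-Probability.Probability"
begin

definition spectral_norm :: "real^'n^'m \<Rightarrow> real" where
  "spectral_norm A = onorm (\<lambda>x. A *v x)"

definition frobenius_norm :: "real^'n^'m \<Rightarrow> real" where
  "frobenius_norm A = sqrt (\<Sum>i\<in>UNIV. \<Sum>j\<in>UNIV. (A $ i $ j)\<^sup>2)"

(* The constraint 0 < M is needed: for M \<le> 0 the inequality holds trivially (1 / 0 = 0 in HOL).
   The least such M exists when A has full column rank, see is_least_norm_pinv below. *)
definition norm_pinv :: "real^'n^'m \<Rightarrow> real" where
  "norm_pinv A = (LEAST M. 0 < M \<and> (\<forall>x. norm (A *v x) \<ge> 1 / M * norm x))"

definition relative_cond :: "real^'n^'m \<Rightarrow> real" where
  "relative_cond A = spectral_norm A * norm_pinv A"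

definition scaled_cond :: "real^'n^'m \<Rightarrow> real" where
  "scaled_cond A = frobenius_norm A * norm_pinv A"

(* embed_pmf yields the stated point probabilities only if A is nonzero, see pmf_dsgs_index;
   this holds whenever A has full column rank. *)
definition dsgs_index :: "real^'n^'m \<Rightarrow> ('m \<times> 'n) pmf" where
  "dsgs_index A =
     embed_pmf (\<lambda>(i, j). (A $ i $ j)\<^sup>2 / (\<Sum>i'\<in>UNIV. \<Sum>j'\<in>UNIV. (A $ i' $ j')\<^sup>2))"

definition dsgs_step ::
  "real^'n^'m \<Rightarrow> real^'m \<Rightarrow> real \<Rightarrow> 'm \<times> 'n \<Rightarrow> real^'n \<Rightarrow> real^'n" where
  "dsgs_step A b \<alpha> = (\<lambda>(i, j) x.
     \<chi> k. if k = j
         then x $ j + \<alpha> * ((b $ i - (\<Sum>l\<in>UNIV. A $ i $ l * x $ l)) / A $ i $ j)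
         else x $ k)"

(* \<omega> r is the index pair selected in the step from iterate r to iterate r + 1. *)
primrec dsgs_iterate ::
  "real^'n^'m \<Rightarrow> real^'m \<Rightarrow> real \<Rightarrow> real^'n \<Rightarrow> (nat \<Rightarrow> 'm \<times> 'n) \<Rightarrow> nat \<Rightarrow> real^'n" where
  "dsgs_iterate A b \<alpha> x0 \<omega> 0 = x0"
| "dsgs_iterate A b \<alpha> x0 \<omega> (Suc r) = dsgs_step A b \<alpha> (\<omega> r) (dsgs_iterate A b \<alpha> x0 \<omega> r)"

(* The infinite product makes the selections in different steps independent. *)
definition dsgs_selections :: "real^'n^'m \<Rightarrow> (nat \<Rightarrow> 'm \<times> 'n) measure" where
  "dsgs_selections A = (\<Pi>\<^sub>M r\<in>UNIV. measure_pmf (dsgs_index A))"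

lemma sum_squares_pos:
  fixes A :: "real^'n^'m"
  assumes "A \<noteq> 0"
  shows "0 < (\<Sum>i\<in>UNIV. \<Sum>j\<in>UNIV. (A $ i $ j)\<^sup>2)"
proof -
  obtain i j where "A $ i $ j \<noteq> 0"
    using assms by (auto simp: vec_eq_iff)
  then have "0 < (\<Sum>j\<in>UNIV. (A $ i $ j)\<^sup>2)"
    by (intro sum_pos2[where i = j]) auto
  then show ?thesis
    by (intro sum_pos2[where i = i]) (auto intro: sum_nonneg)
qed

lemma pmf_dsgs_index:
  fixes A :: "real^'n^'m"
  assumes "A \<noteq> 0"
  shows "pmf (dsgs_index A) (i, j)
    = (A $ i $ j)\<^sup>2 / (\<Sum>i'\<in>UNIV. \<Sum>j'\<in>UNIV. (A $ i' $ j')\<^sup>2)"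
proof -
  let ?S = "\<Sum>i\<in>UNIV. \<Sum>j\<in>UNIV. (A $ i $ j)\<^sup>2"
  let ?f = "\<lambda>(i, j). (A $ i $ j)\<^sup>2 / ?S"
  have pos: "0 < ?S" by (rule sum_squares_pos[OF assms])
  have nn: "\<And>p. 0 \<le> ?f p" using pos by auto
  have "(\<Sum>p\<in>UNIV. ?f p) = (\<Sum>i\<in>UNIV. \<Sum>j\<in>UNIV. (A $ i $ j)\<^sup>2 / ?S)"
    unfolding UNIV_Times_UNIV[symmetric] by (simp add: sum.cartesian_product)
  also have "\<dots> = 1"
    using pos by (simp add: sum_divide_distrib[symmetric])
  finally have "(\<integral>\<^sup>+ p. ennreal (?f p) \<partial>count_space UNIV) = 1"
    using nn by (simp add: nn_integral_count_space_finite sum_ennreal)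
  then show ?thesis
    unfolding dsgs_index_def using pmf_embed_pmf[of ?f "(i, j)"] nn by simp
qed

lemma is_least_norm_pinv:
  fixes A :: "real^'n^'m"
  assumes "rank A = CARD('n)"
  shows "0 < norm_pinv A \<and> (\<forall>x. norm (A *v x) \<ge> 1 / norm_pinv A * norm x)"
    and "\<And>M. 0 < M \<Longrightarrow> (\<forall>x. norm (A *v x) \<ge> 1 / M * norm x) \<Longrightarrow> norm_pinv A \<le> M"
proof -
  let ?P = "\<lambda>M. 0 < M \<and> (\<forall>x. norm (A *v x) \<ge> 1 / M * norm x)"
  have inj: "inj ((*v) A)" using assms by (simp add: full_rank_injective)
  let ?S = "sphere (0::real^'n) 1"
  have "continuous_on ?S (\<lambda>x. norm (A *v x))"
    by (intro continuous_intros)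
  moreover have "?S \<noteq> {}" by simp
  ultimately obtain x0 where x0: "x0 \<in> ?S" "\<And>y. y \<in> ?S \<Longrightarrow> norm (A *v x0) \<le> norm (A *v y)"
    using continuous_attains_inf[OF compact_sphere] by blast
  let ?c = "norm (A *v x0)"
  have "x0 \<noteq> 0" using x0 by auto
  then have "A *v x0 \<noteq> 0" using inj by (metis injD matrix_vector_mult_0_right)
  then have c: "0 < ?c" by simp
  have *: "?c * norm x \<le> norm (A *v x)" for x
  proof (cases "x = 0")
    case False
    have "?c \<le> norm (A *v ((1 / norm x) *\<^sub>R x))" using False by (intro x0(2)) simp
    also have "\<dots> = norm (A *v x) / norm x"
      by (simp add: matrix_vector_mult_scaleR)
    finally show ?thesis using False by (simp add: field_simps)
  qed simp
  have P: "?P (1 / ?c)" using c * by simp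
  have min: "1 / ?c \<le> M" if "?P M" for M
  proof -
    have "1 / M * norm x0 \<le> ?c" using that by blast
    then show ?thesis using x0(1) that c by (simp add: field_simps)
  qed
  have eq: "norm_pinv A = 1 / ?c"
    unfolding norm_pinv_def using P min by (rule Least_equality)
  show "?P (norm_pinv A)" unfolding eq by (rule P)
  show "\<And>M. 0 < M \<Longrightarrow> (\<forall>x. norm (A *v x) \<ge> 1 / M * norm x) \<Longrightarrow> norm_pinv A \<le> M"
    unfolding eq using min by blast
qed

end

theory Submission
  imports Defs
begin

text \<open>
  Write \<open>\<Delta> = x - x*\<close>. Since \<open>b = A x*\<close>, the residual \<open>b - A x\<close> equals \<open>- A \<Delta>\<close>, and selecting
  \<open>(i, j)\<close> moves the \<open>j\<close>-th coordinate of \<open>\<Delta>\<close> by \<open>- \<alpha> (A \<Delta>)\<^sub>i / a\<^sub>i\<^sub>j\<close>. The selection probability is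
  proportional to \<open>a\<^sub>i\<^sub>j\<^sup>2\<close>, which clears the denominators of \<open>\<parallel>\<Delta>\<^sup>+\<parallel>\<^sup>2\<close>: the linear term contributes
  \<open>- 2 \<alpha> a\<^sub>i\<^sub>j \<Delta>\<^sub>j (A \<Delta>)\<^sub>i\<close>, which sums to \<open>- 2 \<alpha> \<parallel>A \<Delta>\<parallel>\<^sup>2\<close>, and the quadratic term contributes
  \<open>\<alpha>\<^sup>2 (A \<Delta>)\<^sub>i\<^sup>2\<close> for each nonzero entry of row \<open>i\<close>, hence at most \<open>n \<alpha>\<^sup>2 \<parallel>A \<Delta>\<parallel>\<^sup>2\<close> in total. Zero
  entries are the only reason why the bound on the expectation is not an equality
  (\<open>expectation_dsgs_step_le\<close>).

  When \<open>n \<alpha>\<^sup>2 - 2 \<alpha> \<le> 0\<close>, the lower bound \<open>\<parallel>A \<Delta>\<parallel> \<ge> \<parallel>\<Delta>\<parallel> / \<parallel>A\<^sup>\<dagger>\<parallel>\<close> turns this into a contraction of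
  the mean squared error (\<open>expectation_dsgs_step_contraction\<close>), whose factor for \<open>\<alpha> = 1/n\<close> is
  \<open>1 - 1 / (n \<kappa>\<^sup>2)\<close>. The weaker factor in terms of \<open>k\<close> comes from \<open>\<parallel>A\<parallel>\<^sub>F\<^sup>2 \<le> n \<parallel>A\<parallel>\<^sub>2\<^sup>2\<close>.

  The contraction holds uniformly in the starting point, so it can be iterated: a sequence of
  independent selections is a first selection followed by an independent sequence with the same
  distribution, and conditioning on the first selection gives an induction on the number of steps
  in which the starting point varies (\<open>nn_integral_dsgs_iterate_le\<close>).
\<close>

section \<open>One step of the algorithm\<close>

lemma dsgs_step_error:
  fixes A :: "real^'n^'m"
  assumes "A *v xs = b"
  shows "dsgs_step A b \<alpha> (i, j) x - xs
    = (x - xs) - axis j (\<alpha> * ((A *v (x - xs)) $ i / A $ i $ j))"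
proof -
  have "b $ i - (\<Sum>l\<in>UNIV. A $ i $ l * x $ l) = - (A *v (x - xs)) $ i"
    using assms by (auto simp: matrix_vector_mult_diff_distrib) (simp add: matrix_vector_mult_def)
  then show ?thesis
    by (simp add: dsgs_step_def vec_eq_iff axis_def)
qed

lemma norm_diff_axis_power2:
  fixes d :: "real^'n"
  shows "(norm (d - axis j t))\<^sup>2 = (norm d)\<^sup>2 - 2 * t * d $ j + t\<^sup>2"
  unfolding power2_norm_eq_inner
  by (simp add: inner_diff_left inner_diff_right inner_axis inner_axis' inner_axis_axis
      power2_eq_square algebra_simps)

text \<open>The weight cancels the denominators of the step. For \<open>a\<^sub>i\<^sub>j \<noteq> 0\<close> this is an equality; for
  \<open>a\<^sub>i\<^sub>j = 0\<close> the left side vanishes and only the last summand remains on the right.\<close>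

lemma weighted_dsgs_step_error_le:
  fixes A :: "real^'n^'m" and x xs :: "real^'n"
  assumes "A *v xs = b"
  defines "d \<equiv> x - xs"
  shows "(A $ i $ j)\<^sup>2 * (norm (dsgs_step A b \<alpha> (i, j) x - xs))\<^sup>2
    \<le> (A $ i $ j)\<^sup>2 * (norm d)\<^sup>2 - 2 * \<alpha> * (A $ i $ j * d $ j * (A *v d) $ i)
      + \<alpha>\<^sup>2 * ((A *v d) $ i)\<^sup>2"
proof (cases "A $ i $ j = 0")
  case False
  define t where "t = \<alpha> * ((A *v d) $ i / A $ i $ j)"
  have clear: "A $ i $ j * t = \<alpha> * (A *v d) $ i"
    using False by (simp add: t_def)
  have "(A $ i $ j)\<^sup>2 * (norm (dsgs_step A b \<alpha> (i, j) x - xs))\<^sup>2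
      = (A $ i $ j)\<^sup>2 * ((norm d)\<^sup>2 - 2 * t * d $ j + t\<^sup>2)"
    unfolding dsgs_step_error[OF assms(1)] d_def[symmetric] norm_diff_axis_power2 t_def ..
  also have "\<dots> = (A $ i $ j)\<^sup>2 * (norm d)\<^sup>2 - 2 * (A $ i $ j * d $ j) * (A $ i $ j * t)
      + (A $ i $ j * t)\<^sup>2"
    by (simp add: power2_eq_square algebra_simps)
  finally show ?thesis
    unfolding clear by (simp add: power_mult_distrib mult_ac)
qed simp

lemma expectation_dsgs_index:
  fixes A :: "real^'n^'m" and f :: "'m \<times> 'n \<Rightarrow> real"
  assumes "A \<noteq> 0"
  shows "measure_pmf.expectation (dsgs_index A) f
    = (\<Sum>i\<in>UNIV. \<Sum>j\<in>UNIV. (A $ i $ j)\<^sup>2 * f (i, j)) / (\<Sum>i\<in>UNIV. \<Sum>j\<in>UNIV. (A $ i $ j)\<^sup>2)"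
proof -
  have "measure_pmf.expectation (dsgs_index A) f
      = (\<Sum>p\<in>UNIV \<times> UNIV. f p * pmf (dsgs_index A) p)"
    by (subst integral_measure_pmf_real[where A = UNIV]) auto
  also have "\<dots> = (\<Sum>i\<in>UNIV. \<Sum>j\<in>UNIV. f (i, j) * pmf (dsgs_index A) (i, j))"
    by (simp add: sum.cartesian_product)
  finally show ?thesis
    by (simp add: pmf_dsgs_index[OF assms] sum_divide_distrib mult.commute)
qed

lemma norm_matrix_vector_mult_power2:
  fixes A :: "real^'n^'m"
  shows "(norm (A *v d))\<^sup>2 = (\<Sum>i\<in>UNIV. ((A *v d) $ i)\<^sup>2)"
  unfolding power2_norm_eq_inner by (simp add: inner_vec_def power2_eq_square)

lemma expectation_dsgs_step_le:
  fixes A :: "real^'n^'m"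
  assumes "A \<noteq> 0" and "A *v xs = b"
  shows "measure_pmf.expectation (dsgs_index A) (\<lambda>p. (norm (dsgs_step A b \<alpha> p x - xs))\<^sup>2)
    \<le> (norm (x - xs))\<^sup>2 + (real CARD('n) * \<alpha>\<^sup>2 - 2 * \<alpha>) / (\<Sum>i\<in>UNIV. \<Sum>j\<in>UNIV. (A $ i $ j)\<^sup>2)
        * (norm (A *v (x - xs)))\<^sup>2"
proof -
  define d where "d = x - xs"
  define S where "S = (\<Sum>i\<in>UNIV. \<Sum>j\<in>UNIV. (A $ i $ j)\<^sup>2)"
  have S: "0 < S"
    unfolding S_def by (rule sum_squares_pos[OF assms(1)])
  have "(\<Sum>i\<in>UNIV. \<Sum>j\<in>UNIV. (A $ i $ j)\<^sup>2 * (norm (dsgs_step A b \<alpha> (i, j) x - xs))\<^sup>2)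
      \<le> (\<Sum>i\<in>UNIV. \<Sum>j\<in>UNIV. (A $ i $ j)\<^sup>2 * (norm d)\<^sup>2
            - 2 * \<alpha> * (A $ i $ j * d $ j * (A *v d) $ i) + \<alpha>\<^sup>2 * ((A *v d) $ i)\<^sup>2)"
    unfolding d_def by (intro sum_mono weighted_dsgs_step_error_le[OF assms(2)])
  also have "\<dots> = S * (norm d)\<^sup>2
      - 2 * \<alpha> * (\<Sum>i\<in>UNIV. \<Sum>j\<in>UNIV. A $ i $ j * d $ j * (A *v d) $ i)
      + real CARD('n) * \<alpha>\<^sup>2 * (norm (A *v d))\<^sup>2"
    by (simp add: S_def norm_matrix_vector_mult_power2 sum.distrib sum_subtractf
        sum_distrib_left sum_distrib_right mult.assoc)
  also have "(\<Sum>i\<in>UNIV. \<Sum>j\<in>UNIV. A $ i $ j * d $ j * (A *v d) $ i) = (norm (A *v d))\<^sup>2"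
    unfolding norm_matrix_vector_mult_power2
    by (simp add: sum_distrib_right[symmetric] power2_eq_square)
      (simp add: matrix_vector_mult_def)
  finally show ?thesis
    unfolding expectation_dsgs_index[OF assms(1)] S_def[symmetric] d_def[symmetric]
    using S by (simp add: field_simps)
qed

lemma inner_identity_plus_gram:
  fixes A :: "real^'n^'m"
  shows "d \<bullet> ((mat 1 + c *\<^sub>R (transpose A ** A)) *v d) = (norm d)\<^sup>2 + c * (norm (A *v d))\<^sup>2"
proof -
  have "d \<bullet> ((transpose A ** A) *v d) = (norm (A *v d))\<^sup>2"
    unfolding power2_norm_eq_inner
    by (metis dot_lmul_matrix inner_commute matrix_vector_mul_assoc transpose_matrix_vector)
  then show ?thesis
    by (simp add: matrix_vector_mult_add_rdistrib scaleR_matrix_vector_assoc[symmetric]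
        inner_add_right power2_norm_eq_inner)
qed

section \<open>Contraction factors\<close>

lemma norm_matrix_vector_mult_ge_norm_pinv:
  fixes A :: "real^'n^'m"
  assumes "rank A = CARD('n)"
  shows "(norm d)\<^sup>2 / (norm_pinv A)\<^sup>2 \<le> (norm (A *v d))\<^sup>2"
proof -
  have "norm d / norm_pinv A \<le> norm (A *v d)" and "0 < norm_pinv A"
    using is_least_norm_pinv(1)[OF assms] by auto
  then have "(norm d / norm_pinv A)\<^sup>2 \<le> (norm (A *v d))\<^sup>2"
    by (intro power_mono) auto
  then show ?thesis
    by (simp add: power_divide)
qed

lemma frobenius_norm_power2:
  "(frobenius_norm A)\<^sup>2 = (\<Sum>i\<in>UNIV. \<Sum>j\<in>UNIV. (A $ i $ j)\<^sup>2)"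
  unfolding frobenius_norm_def by (simp add: sum_nonneg)

lemma nonzero_if_full_column_rank:
  fixes A :: "real^'n^'m"
  assumes "rank A = CARD('n)"
  shows "A \<noteq> 0"
  using assms by auto

lemma scaled_cond_pos:
  fixes A :: "real^'n^'m"
  assumes "rank A = CARD('n)"
  shows "0 < scaled_cond A"
  unfolding scaled_cond_def frobenius_norm_def
  using sum_squares_pos[OF nonzero_if_full_column_rank[OF assms]] is_least_norm_pinv(1)[OF assms]
  by simp

text \<open>The condition on \<open>\<alpha>\<close> makes the coefficient of \<open>\<parallel>A \<Delta>\<parallel>\<^sup>2\<close> nonpositive, so a lower bound on
  \<open>\<parallel>A \<Delta>\<parallel>\<close> gives an upper bound on the expectation.\<close>

lemma expectation_dsgs_step_contraction:
  fixes A :: "real^'n^'m"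
  assumes "rank A = CARD('n)" and "A *v xs = b" and "real CARD('n) * \<alpha>\<^sup>2 \<le> 2 * \<alpha>"
  shows "measure_pmf.expectation (dsgs_index A) (\<lambda>p. (norm (dsgs_step A b \<alpha> p x - xs))\<^sup>2)
    \<le> (1 - (2 * \<alpha> - real CARD('n) * \<alpha>\<^sup>2) / (scaled_cond A)\<^sup>2) * (norm (x - xs))\<^sup>2"
proof -
  define c where "c = (2 * \<alpha> - real CARD('n) * \<alpha>\<^sup>2) / (frobenius_norm A)\<^sup>2"
  have "0 \<le> c"
    unfolding c_def using assms(3) by simp
  have "measure_pmf.expectation (dsgs_index A) (\<lambda>p. (norm (dsgs_step A b \<alpha> p x - xs))\<^sup>2)
      \<le> (norm (x - xs))\<^sup>2 - c * (norm (A *v (x - xs)))\<^sup>2"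
    using expectation_dsgs_step_le[OF nonzero_if_full_column_rank[OF assms(1)] assms(2), of \<alpha> x]
    unfolding frobenius_norm_power2[symmetric] c_def
    by (simp add: diff_divide_distrib left_diff_distrib)
  also have "\<dots> \<le> (norm (x - xs))\<^sup>2 - c * ((norm (x - xs))\<^sup>2 / (norm_pinv A)\<^sup>2)"
    using norm_matrix_vector_mult_ge_norm_pinv[OF assms(1), of "x - xs"] \<open>0 \<le> c\<close>
    by (intro diff_left_mono mult_left_mono)
  finally show ?thesis
    unfolding c_def scaled_cond_def by (simp add: power_mult_distrib algebra_simps)
qed

text \<open>Summing \<open>\<parallel>A e\<^sub>j\<parallel>\<^sup>2 \<le> \<parallel>A\<parallel>\<^sub>2\<^sup>2\<close> over the \<open>n\<close> unit vectors bounds \<open>\<parallel>A\<parallel>\<^sub>F\<^sup>2\<close>, since the \<open>A e\<^sub>j\<close> are the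
  columns of \<open>A\<close>.\<close>

lemma frobenius_norm_le_spectral_norm:
  fixes A :: "real^'n^'m"
  shows "(frobenius_norm A)\<^sup>2 \<le> real CARD('n) * (spectral_norm A)\<^sup>2"
proof -
  have column: "(\<Sum>i\<in>UNIV. (A $ i $ j)\<^sup>2) \<le> (spectral_norm A)\<^sup>2" for j
  proof -
    have "norm (A *v axis j 1) \<le> spectral_norm A"
      using onorm[OF matrix_vector_mul_bounded_linear[of A], of "axis j 1"]
      by (simp add: spectral_norm_def)
    then have "(norm (A *v axis j 1))\<^sup>2 \<le> (spectral_norm A)\<^sup>2"
      by (intro power_mono) auto
    then show ?thesis
      unfolding norm_matrix_vector_mult_power2 by (simp add: matrix_vector_mult_basis column_def)
  qed
  have "(frobenius_norm A)\<^sup>2 = (\<Sum>j\<in>UNIV. \<Sum>i\<in>UNIV. (A $ i $ j)\<^sup>2)"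
    unfolding frobenius_norm_power2 by (rule sum.swap)
  also have "\<dots> \<le> (\<Sum>j\<in>(UNIV :: 'n set). (spectral_norm A)\<^sup>2)"
    by (intro sum_mono column)
  finally show ?thesis
    by simp
qed

lemma scaled_cond_le_relative_cond:
  fixes A :: "real^'n^'m"
  shows "(scaled_cond A)\<^sup>2 \<le> real CARD('n) * (relative_cond A)\<^sup>2"
  unfolding scaled_cond_def relative_cond_def power_mult_distrib mult.assoc[symmetric]
  by (intro mult_right_mono frobenius_norm_le_spectral_norm) simp

section \<open>Mean squared error of the iterates\<close>

lemma dsgs_iterate_case_nat:
  "dsgs_iterate A b \<alpha> x0 (case_nat p \<omega>) (Suc r)
    = dsgs_iterate A b \<alpha> (dsgs_step A b \<alpha> p x0) \<omega> r"
  by (induction r) auto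

lemma borel_measurable_dsgs_step:
  fixes A :: "real^'n^'m"
  shows "dsgs_step A b \<alpha> p \<in> borel_measurable borel"
proof (cases p)
  case (Pair i j)
  have "continuous_on UNIV (\<lambda>x. dsgs_step A b \<alpha> (i, j) x $ k)" for k
    by (cases "k = j") (auto simp: dsgs_step_def divide_inverse intro!: continuous_intros)
  then have "continuous_on UNIV (dsgs_step A b \<alpha> (i, j))"
    using continuous_on_vec_lambda[of UNIV "\<lambda>k x. dsgs_step A b \<alpha> (i, j) x $ k"] by simp
  then show ?thesis
    unfolding Pair by (rule borel_measurable_continuous_onI)
qed

text \<open>There are only finitely many index pairs, so the step need not be measured jointly in the
  pair and the point: measurability for each fixed pair suffices.\<close>

lemma borel_measurable_dsgs_iterate:
  fixes A :: "real^'n^'m"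
  shows "(\<lambda>\<omega>. dsgs_iterate A b \<alpha> x0 \<omega> r) \<in> borel_measurable (dsgs_selections A)"
proof (induction r)
  case (Suc r)
  have "(\<lambda>\<omega>. \<omega> r) \<in> measurable (dsgs_selections A) (measure_pmf (dsgs_index A))"
    unfolding dsgs_selections_def by (rule measurable_component_singleton) simp
  then have selection: "(\<lambda>\<omega>. \<omega> r) \<in> measurable (dsgs_selections A) (count_space UNIV)"
    by simp
  have "(\<lambda>\<omega>. dsgs_step A b \<alpha> p (dsgs_iterate A b \<alpha> x0 \<omega> r))
      \<in> borel_measurable (dsgs_selections A)" for p
    by (rule measurable_compose[OF Suc borel_measurable_dsgs_step])
  then show ?case
    using measurable_compose_countable'[OF _ selection,
        where f = "\<lambda>p \<omega>. dsgs_step A b \<alpha> p (dsgs_iterate A b \<alpha> x0 \<omega> r)"] by simp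
qed simp

lemma borel_measurable_dsgs_iterate_error:
  fixes A :: "real^'n^'m"
  shows "(\<lambda>\<omega>. (norm (dsgs_iterate A b \<alpha> x0 \<omega> r - xs))\<^sup>2) \<in> borel_measurable (dsgs_selections A)"
  using borel_measurable_dsgs_iterate by measurable

text \<open>A sequence of independent selections is distributed like an independent first selection
  followed by such a sequence.\<close>

lemma nn_integral_dsgs_selections_first:
  fixes A :: "real^'n^'m"
  assumes f: "f \<in> borel_measurable (dsgs_selections A)"
  shows "(\<integral>\<^sup>+\<omega>. f \<omega> \<partial>dsgs_selections A)
    = (\<integral>\<^sup>+p. \<integral>\<^sup>+\<omega>. f (case_nat p \<omega>) \<partial>dsgs_selections A \<partial>measure_pmf (dsgs_index A))"
proof -
  let ?M = "measure_pmf (dsgs_index A)" and ?S = "dsgs_selections A"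
  interpret sequence_space ?M ..
  interpret selections: prob_space ?S
    unfolding dsgs_selections_def by (rule prob_space_PiM) (rule prob_space_measure_pmf)
  have prepend: "(\<lambda>(p, \<omega>). case_nat p \<omega>) \<in> measurable (?M \<Otimes>\<^sub>M ?S) ?S"
    unfolding dsgs_selections_def by measurable
  have "(\<integral>\<^sup>+\<omega>. f \<omega> \<partial>?S) = (\<integral>\<^sup>+\<omega>. f \<omega> \<partial>distr (?M \<Otimes>\<^sub>M ?S) ?S (\<lambda>(p, \<omega>). case_nat p \<omega>))"
    using PiM_iter unfolding dsgs_selections_def by simp
  also have "\<dots> = (\<integral>\<^sup>+z. f (case z of (p, \<omega>) \<Rightarrow> case_nat p \<omega>) \<partial>(?M \<Otimes>\<^sub>M ?S))"
    by (rule nn_integral_distr[OF prepend]) (use f in simp)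
  also have "\<dots> = (\<integral>\<^sup>+p. \<integral>\<^sup>+\<omega>. f (case_nat p \<omega>) \<partial>?S \<partial>?M)"
    using selections.nn_integral_fst[OF measurable_compose[OF prepend f]] by simp
  finally show ?thesis .
qed

text \<open>Nonnegative extended integrals keep integrability out of the induction. The starting point
  varies because the hypothesis is applied after the first step.\<close>

lemma nn_integral_dsgs_iterate_le:
  fixes A :: "real^'n^'m"
  assumes "0 \<le> \<rho>"
    and step: "\<And>x. measure_pmf.expectation (dsgs_index A) (\<lambda>p. (norm (dsgs_step A b \<alpha> p x - xs))\<^sup>2)
      \<le> \<rho> * (norm (x - xs))\<^sup>2"
  shows "(\<integral>\<^sup>+\<omega>. ennreal ((norm (dsgs_iterate A b \<alpha> x0 \<omega> r - xs))\<^sup>2) \<partial>dsgs_selections A)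
    \<le> ennreal (\<rho> ^ r * (norm (x0 - xs))\<^sup>2)"
proof (induction r arbitrary: x0)
  case 0
  interpret prob_space "dsgs_selections A"
    unfolding dsgs_selections_def by (rule prob_space_PiM) (rule prob_space_measure_pmf)
  show ?case
    by (simp add: emeasure_space_1)
next
  case (Suc r)
  let ?M = "measure_pmf (dsgs_index A)"
  have "(\<integral>\<^sup>+\<omega>. ennreal ((norm (dsgs_iterate A b \<alpha> x0 \<omega> (Suc r) - xs))\<^sup>2) \<partial>dsgs_selections A)
      = (\<integral>\<^sup>+p. \<integral>\<^sup>+\<omega>. ennreal ((norm (dsgs_iterate A b \<alpha> (dsgs_step A b \<alpha> p x0) \<omega> r - xs))\<^sup>2)
          \<partial>dsgs_selections A \<partial>?M)"
    unfolding dsgs_iterate_case_nat[symmetric]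
    by (intro nn_integral_dsgs_selections_first
        measurable_compose[OF borel_measurable_dsgs_iterate_error measurable_ennreal])
  also have "\<dots> \<le> (\<integral>\<^sup>+p. ennreal (\<rho> ^ r * (norm (dsgs_step A b \<alpha> p x0 - xs))\<^sup>2) \<partial>?M)"
    by (intro nn_integral_mono Suc)
  also have "\<dots> = ennreal (\<integral>p. \<rho> ^ r * (norm (dsgs_step A b \<alpha> p x0 - xs))\<^sup>2 \<partial>?M)"
    using assms(1) by (intro nn_integral_eq_integral integrable_measure_pmf_finite) auto
  also have "\<dots> \<le> ennreal (\<rho> ^ r * (\<rho> * (norm (x0 - xs))\<^sup>2))"
    using assms(1) step by (auto intro!: ennreal_leI mult_left_mono)
  finally show ?case
    by (simp add: mult_ac)
qed

lemma integral_dsgs_iterate_le: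
  fixes A :: "real^'n^'m"
  assumes "0 \<le> \<rho>"
    and "\<And>x. measure_pmf.expectation (dsgs_index A) (\<lambda>p. (norm (dsgs_step A b \<alpha> p x - xs))\<^sup>2)
      \<le> \<rho> * (norm (x - xs))\<^sup>2"
  shows "(\<integral>\<omega>. (norm (dsgs_iterate A b \<alpha> x0 \<omega> r - xs))\<^sup>2 \<partial>dsgs_selections A)
    \<le> \<rho> ^ r * (norm (x0 - xs))\<^sup>2"
proof -
  have "(\<integral>\<omega>. (norm (dsgs_iterate A b \<alpha> x0 \<omega> r - xs))\<^sup>2 \<partial>dsgs_selections A)
      = enn2real (\<integral>\<^sup>+\<omega>. ennreal ((norm (dsgs_iterate A b \<alpha> x0 \<omega> r - xs))\<^sup>2) \<partial>dsgs_selections A)"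
    by (intro integral_eq_nn_integral borel_measurable_dsgs_iterate_error) simp
  also have "\<dots> \<le> \<rho> ^ r * (norm (x0 - xs))\<^sup>2"
    using assms(1) nn_integral_dsgs_iterate_le[OF assms] by (intro enn2real_leI) auto
  finally show ?thesis .
qed

section \<open>Convergence of the algorithm\<close>

theorem theorem1:
  fixes A :: "real^'n^'m"
  assumes full_column_rank: "rank A = CARD('n)"
  shows
    "(\<forall>(b :: real^'m) (xs :: real^'n) (\<alpha> :: real) (x :: real^'n).
        A *v xs = b \<and> 0 < \<alpha> \<longrightarrow>
        measure_pmf.expectation (dsgs_index A) (\<lambda>p. (norm (dsgs_step A b \<alpha> p x - xs))\<^sup>2)
        \<le> (x - xs) \<bullet>
            ((mat 1 + ((real CARD('n) * \<alpha>\<^sup>2 - 2 * \<alpha>) / (\<Sum>i\<in>UNIV. \<Sum>j\<in>UNIV. (A $ i $ j)\<^sup>2))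
                *\<^sub>R (transpose A ** A)) *v (x - xs)))
     \<and>
     (\<forall>\<alpha> :: real. 0 < \<alpha> \<and> \<alpha> < 2 / real CARD('n) \<longrightarrow>
        (\<exists>\<rho> :: real. 0 \<le> \<rho> \<and> \<rho> < 1 \<and>
          (\<forall>(b :: real^'m) (xs :: real^'n) (x0 :: real^'n) (r :: nat).
             A *v xs = b \<longrightarrow>
             (\<integral>\<omega>. (norm (dsgs_iterate A b \<alpha> x0 \<omega> r - xs))\<^sup>2 \<partial>dsgs_selections A)
             \<le> \<rho> ^ r * (norm (x0 - xs))\<^sup>2)))
     \<and>
     (\<forall>(b :: real^'m) (xs :: real^'n) (x :: real^'n).
        A *v xs = b \<longrightarrow>
        measure_pmf.expectation (dsgs_index A)
          (\<lambda>p. (norm (dsgs_step A b (1 / real CARD('n)) p x - xs))\<^sup>2)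
        \<le> (1 - 1 / (real CARD('n) * (scaled_cond A)\<^sup>2)) * (norm (x - xs))\<^sup>2
        \<and>
        (1 - 1 / (real CARD('n) * (scaled_cond A)\<^sup>2)) * (norm (x - xs))\<^sup>2
        \<le> (1 - 1 / ((real CARD('n))\<^sup>2 * (relative_cond A)\<^sup>2)) * (norm (x - xs))\<^sup>2)"
proof (intro conjI allI impI, goal_cases)
  case (1 b xs \<alpha> x)
  then show ?case
    unfolding inner_identity_plus_gram
    using expectation_dsgs_step_le[OF nonzero_if_full_column_rank[OF full_column_rank]] by blast
next
  case (2 \<alpha>)
  define gain where "gain = 2 * \<alpha> - real CARD('n) * \<alpha>\<^sup>2"
  have "\<alpha> * (real CARD('n) * \<alpha>) < \<alpha> * 2"
    using 2 by (intro mult_strict_left_mono) (auto simp: field_simps)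
  then have gain: "0 < gain"
    by (simp add: gain_def power2_eq_square algebra_simps)
  \<comment> \<open>The maximum makes \<open>\<rho>\<close> nonnegative, as iterating the one-step bound requires.\<close>
  define \<rho> where "\<rho> = max 0 (1 - gain / (scaled_cond A)\<^sup>2)"
  have nonneg: "0 \<le> \<rho>" and less_1: "\<rho> < 1"
    unfolding \<rho>_def using gain scaled_cond_pos[OF full_column_rank] by auto
  have step: "measure_pmf.expectation (dsgs_index A) (\<lambda>p. (norm (dsgs_step A b \<alpha> p x - xs))\<^sup>2)
      \<le> \<rho> * (norm (x - xs))\<^sup>2" if "A *v xs = b" for b :: "real^'m" and xs x :: "real^'n"
  proof -
    have "measure_pmf.expectation (dsgs_index A) (\<lambda>p. (norm (dsgs_step A b \<alpha> p x - xs))\<^sup>2)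
        \<le> (1 - gain / (scaled_cond A)\<^sup>2) * (norm (x - xs))\<^sup>2"
      unfolding gain_def using gain
      by (intro expectation_dsgs_step_contraction[OF full_column_rank that]) (simp add: gain_def)
    also have "\<dots> \<le> \<rho> * (norm (x - xs))\<^sup>2"
      unfolding \<rho>_def by (intro mult_right_mono) auto
    finally show ?thesis .
  qed
  show ?case
    by (intro exI[of _ \<rho>] conjI allI impI nonneg less_1 integral_dsgs_iterate_le step)
next
  case (3 b xs x)
  have square: "real CARD('n) * (1 / real CARD('n))\<^sup>2 = 1 / real CARD('n)"
    by (simp add: power2_eq_square)
  have "real CARD('n) * (1 / real CARD('n))\<^sup>2 \<le> 2 * (1 / real CARD('n))"
    unfolding square by (simp add: divide_right_mono)
  from expectation_dsgs_step_contraction[OF full_column_rank 3 this, of x]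
  show ?case
    unfolding square by simp
next
  case (4 b xs x)
  have "real CARD('n) * (scaled_cond A)\<^sup>2
      \<le> real CARD('n) * (real CARD('n) * (relative_cond A)\<^sup>2)"
    by (intro mult_left_mono scaled_cond_le_relative_cond) simp
  then have "real CARD('n) * (scaled_cond A)\<^sup>2 \<le> (real CARD('n))\<^sup>2 * (relative_cond A)\<^sup>2"
    by (simp add: power2_eq_square mult.assoc)
  moreover have "0 < real CARD('n) * (scaled_cond A)\<^sup>2"
    using scaled_cond_pos[OF full_column_rank] by simp
  ultimately have "1 / ((real CARD('n))\<^sup>2 * (relative_cond A)\<^sup>2)
      \<le> 1 / (real CARD('n) * (scaled_cond A)\<^sup>2)"
    by (intro divide_left_mono mult_pos_pos) auto
  then show ?case
    by (intro mult_right_mono) auto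
qed

end
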